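(* Let $n\ge 1$, $\epsilon>0$, and $B_\epsilon=\{\delta\in\mathbb{R}^n : \|\delta\|_\infty\le \epsilon\}$. Let $f(\cdot;\theta):\mathbb{R}^n\to\mathbb{R}$ be the loss function of a neural network classifier with fixed parameter $\theta$ (and fixed label $y$), assumed Lipschitz continuous and differentiable in its input, with gradient $\nabla_x f(\cdot;\theta)$. Let $x\in\mathbb{R}^n$ and $\delta\in B_\epsilon$. Suppose that: (1) (Lipschitzian smoothness) $l_{xx}>0$ is a constant such that $f(\cdot;\theta)$ satisfies $$\|\nabla_x f(x';\theta)-\nabla_x f(x'+\delta';\theta)\|_1\le l_{xx}\|\delta'\|_\infty\quad\text{for all } x'\in\mathbb{R}^n \text{ and all } \delta'\in B_\epsilon;$$ (2) (existence of a stationary point) there exists $\delta^*\in B_\epsilon$ such that $\nabla_x f(x+\delta^*;\theta)=0$. Then $$\frac{\|\nabla_x f(x+\delta;\theta)\|_1}{2n\epsilon}\le l_{xx}.$$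
   Context: Here $f(x;\theta)$ is shorthand for $L(F(x;\theta),y)$, where $F(\cdot;\theta):\mathbb{R}^n\to\mathbb{R}^C$ is a neural network classifier with parameter $\theta$, $L$ is a loss function and $y$ is the ground truth label of the example $x$. The parameter $\theta$ and label $y$ are fixed, so $f(\cdot;\theta)$ is regarded as a real-valued function on $\mathbb{R}^n$. The standing assumption is that $F$ and $L$ are Lipschitz continuous. $\nabla_x f(z;\theta)$ denotes the gradient of $f(\cdot;\theta)$ with respect to its input, evaluated at $z\in\mathbb{R}^n$. $\|\cdot\|_1$ and $\|\cdot\|_\infty$ are the usual $\ell_1$ and $\ell_\infty$ norms on $\mathbb{R}^n$ (dual to each other), and $B_\epsilon$ is the closed $\ell_\infty$ ball of radius $\epsilon$ centred at the origin. *)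

theory Defs
  imports "HOL-Analysis.Analysis"
begin

definition l1norm :: "real ^ 'n \<Rightarrow> real" where
  "l1norm v = (\<Sum>i\<in>UNIV. \<bar>v $ i\<bar>)"

text \<open>The \<open>\<ell>\<^sub>\<infinity>\<close> norm is the library's \<^const>\<open>infnorm\<close>, which on \<open>real ^ 'n\<close> is the maximum of
  the absolute values of the coordinates.\<close>

definition linf_ball :: "real \<Rightarrow> (real ^ 'n) set" where
  "linf_ball \<epsilon> = {\<delta>. infnorm \<delta> \<le> \<epsilon>}"

text \<open>Meaningful only where \<open>f\<close> is differentiable: there the description is satisfied by
  exactly one vector.\<close>

definition gradient :: "(real ^ 'n \<Rightarrow> real) \<Rightarrow> real ^ 'n \<Rightarrow> real ^ 'n" where
  "gradient f z = (THE g. GDERIV f z :> g)"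

end

theory Submission
  imports Defs
begin

text \<open>Two points of the ball of radius \<open>\<epsilon>\<close> may be \<open>2 * \<epsilon>\<close> apart, while the smoothness hypothesis only
  covers displacements up to \<open>\<epsilon>\<close>. Going from \<open>x + \<delta>\<close> to the stationary point through the midpoint
  takes two admissible steps, which bounds the gradient at \<open>x + \<delta>\<close> by \<open>2 * \<epsilon> * l\<^sub>x\<^sub>x\<close>, even without
  the factor \<open>n\<close>.\<close>

lemma l1norm_triangle: "l1norm (u + v) \<le> l1norm u + l1norm v"
  unfolding l1norm_def by (simp add: sum.distrib [symmetric] sum_mono abs_triangle_ineq)

text \<open>The triangle inequality bounds the difference by \<open>2 * \<epsilon>\<close>, and
  halving restores radius \<open>\<epsilon>\<close>.\<close>

lemma half_diff_in_linf_ball: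
  assumes "u \<in> linf_ball \<epsilon>" and "v \<in> linf_ball \<epsilon>"
  shows "(1/2) *\<^sub>R (u - v) \<in> linf_ball \<epsilon>"
proof -
  have "infnorm (u - v) \<le> infnorm u + infnorm v"
    using infnorm_triangle [of u "- v"] by (simp add: infnorm_neg)
  then show ?thesis
    using assms by (simp add: linf_ball_def infnorm_mul)
qed

theorem theorem1:
  fixes F :: "real ^ 'n \<Rightarrow> 'param \<Rightarrow> real ^ 'c"
    and L :: "real ^ 'c \<Rightarrow> 'label \<Rightarrow> real"
    and \<theta> :: 'param and y :: 'label
    and f :: "real ^ 'n \<Rightarrow> real"
    and x \<delta> :: "real ^ 'n"
    and \<epsilon> l\<^sub>x\<^sub>x :: real
  assumes loss: "f = (\<lambda>z. L (F z \<theta>) y)"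
    and lipschitz: "\<exists>K. K-lipschitz_on UNIV f"
    and differentiable: "f differentiable_on UNIV"
    and eps: "\<epsilon> > 0"
    and delta: "\<delta> \<in> linf_ball \<epsilon>"
    and lxx: "l\<^sub>x\<^sub>x > 0"
    and smooth: "\<And>x' \<delta>'. \<delta>' \<in> linf_ball \<epsilon> \<Longrightarrow>
      l1norm (gradient f x' - gradient f (x' + \<delta>')) \<le> l\<^sub>x\<^sub>x * infnorm \<delta>'"
    and stationary: "\<exists>\<delta>\<^sub>s. \<delta>\<^sub>s \<in> linf_ball \<epsilon> \<and> gradient f (x + \<delta>\<^sub>s) = 0"
  shows "l1norm (gradient f (x + \<delta>)) / (2 * real CARD('n) * \<epsilon>) \<le> l\<^sub>x\<^sub>x"
proof -
  obtain \<delta>\<^sub>s where s: "\<delta>\<^sub>s \<in> linf_ball \<epsilon>" "gradient f (x + \<delta>\<^sub>s) = 0"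
    using stationary by blast
  define h where "h = (1/2) *\<^sub>R (\<delta>\<^sub>s - \<delta>)"
  have h: "h \<in> linf_ball \<epsilon>"
    unfolding h_def using s(1) delta by (rule half_diff_in_linf_ball)
  have "h + h = \<delta>\<^sub>s - \<delta>"
    unfolding h_def by (simp flip: scaleR_left_distrib)
  then have end_point: "x + \<delta> + h + h = x + \<delta>\<^sub>s"
    by (simp add: add.assoc)
  \<comment> \<open>Kept general in \<open>z\<close>: it is applied at \<open>x + \<delta>\<close>
    and again at the midpoint.\<close>
  have step: "l1norm (gradient f z - gradient f (z + h)) \<le> l\<^sub>x\<^sub>x * \<epsilon>" for z
    using smooth [OF h, of z] h lxx
    by (auto simp: linf_ball_def intro: order_trans mult_left_mono)
  have "l1norm (gradient f (x + \<delta>))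
      \<le> l1norm (gradient f (x + \<delta>) - gradient f (x + \<delta> + h)) + l1norm (gradient f (x + \<delta> + h))"
    using l1norm_triangle [of "gradient f (x + \<delta>) - gradient f (x + \<delta> + h)"
        "gradient f (x + \<delta> + h)"] by simp
  \<comment> \<open>The second summand is also a difference of gradients one step \<open>h\<close>
    apart, since the gradient vanishes at \<open>x + \<delta>\<^sub>s\<close>.\<close>
  also have "\<dots> \<le> l\<^sub>x\<^sub>x * \<epsilon> + l\<^sub>x\<^sub>x * \<epsilon>"
    using step [of "x + \<delta>"] step [of "x + \<delta> + h"] unfolding end_point s(2) diff_0_right
    by linarith
  also have "\<dots> = l\<^sub>x\<^sub>x * (2 * 1 * \<epsilon>)"
    by simp
  \<comment> \<open>Index types are nonempty, so \<open>CARD('n)\<close> is at least 1 and inserting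
    it only weakens the bound.\<close>
  also have "\<dots> \<le> l\<^sub>x\<^sub>x * (2 * real CARD('n) * \<epsilon>)"
    using lxx eps by (intro mult_left_mono mult_right_mono) (auto simp: Suc_le_eq)
  finally show ?thesis
    using eps by (simp add: divide_le_eq)
qed

end
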